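(* For a function $I:[0,1]^2\to[0,1]$, put $N_I(x)=I(x,0)$ for $x\in[0,1]$. The following statements are equivalent: (i) $I$ is a continuous $(D,N)$-implication in which $N$ is a strict fuzzy negation and $D$ is a fuzzy disjunction with a right neutral element $0$; that is, $I$ is continuous on $[0,1]^2$ and there exist a strict fuzzy negation $N$ and a fuzzy disjunction $D$ with right neutral element $0$ such that $I(x,y)=D(N(x),y)$ for all $x,y\in[0,1]$. (ii) $I$ is a $(D,N_I)$-implication with a continuous fuzzy disjunction $D$ and a strict fuzzy negation $N_I$; that is, $N_I$ is a strict fuzzy negation and there exists a continuous fuzzy disjunction $D$ such that $I(x,y)=D(N_I(x),y)$ for all $x,y\in[0,1]$.
   Context: A fuzzy disjunction is a function $D:[0,1]^2\to[0,1]$ that is non-decreasing in each variable and satisfies $D(0,0)=0$ and $D(1,1)=D(1,0)=D(0,1)=1$. It has right neutral element $0$ if $D(x,0)=x$ for all $x\in[0,1]$. A fuzzy negation is a non-increasing function $N:[0,1]\to[0,1]$ with $N(0)=1$ and $N(1)=0$; it is strict if it is strictly decreasing and continuous. A function $I:[0,1]^2\to[0,1]$ is called a $(D,N)$-implication if there exist a fuzzy disjunction $D$ and a fuzzy negation $N$ such that $I(x,y)=D(N(x),y)$ for all $x,y\in[0,1]$. *)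

theory Defs
  imports "HOL-Analysis.Analysis"
begin

text \<open>
  A function on \<open>[0,1]\<close> or \<open>[0,1]\<^sup>2\<close> is represented by a total function on the reals
  (curried in the binary case) whose values outside the domain are arbitrary.  Every notion
  below depends only on the restriction to the domain.
\<close>

abbreviation unit_interval :: "real set"
  where "unit_interval \<equiv> {0..1}"

definition unit_fun1 :: "(real \<Rightarrow> real) \<Rightarrow> bool" where
  "unit_fun1 f \<longleftrightarrow> (\<forall>x\<in>unit_interval. f x \<in> unit_interval)"

definition unit_fun2 :: "(real \<Rightarrow> real \<Rightarrow> real) \<Rightarrow> bool" where
  "unit_fun2 F \<longleftrightarrow> (\<forall>x\<in>unit_interval. \<forall>y\<in>unit_interval. F x y \<in> unit_interval)"

text \<open>Joint continuity on the square, not continuity in each variable separately.\<close>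

definition continuous_unit2 :: "(real \<Rightarrow> real \<Rightarrow> real) \<Rightarrow> bool" where
  "continuous_unit2 F \<longleftrightarrow>
     continuous_on (unit_interval \<times> unit_interval) (\<lambda>(x, y). F x y)"

definition fuzzy_disjunction :: "(real \<Rightarrow> real \<Rightarrow> real) \<Rightarrow> bool" where
  "fuzzy_disjunction D \<longleftrightarrow>
     unit_fun2 D \<and>
     (\<forall>y\<in>unit_interval. mono_on unit_interval (\<lambda>x. D x y)) \<and>
     (\<forall>x\<in>unit_interval. mono_on unit_interval (\<lambda>y. D x y)) \<and>
     D 0 0 = 0 \<and> D 1 1 = 1 \<and> D 1 0 = 1 \<and> D 0 1 = 1"

definition right_neutral_0 :: "(real \<Rightarrow> real \<Rightarrow> real) \<Rightarrow> bool" where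
  "right_neutral_0 D \<longleftrightarrow> (\<forall>x\<in>unit_interval. D x 0 = x)"

definition fuzzy_negation :: "(real \<Rightarrow> real) \<Rightarrow> bool" where
  "fuzzy_negation N \<longleftrightarrow>
     unit_fun1 N \<and> antimono_on unit_interval N \<and> N 0 = 1 \<and> N 1 = 0"

definition strict_fuzzy_negation :: "(real \<Rightarrow> real) \<Rightarrow> bool" where
  "strict_fuzzy_negation N \<longleftrightarrow>
     fuzzy_negation N \<and> strict_antimono_on unit_interval N \<and> continuous_on unit_interval N"

text \<open>
  The witnesses \<open>D\<close> and \<open>N\<close> are explicit arguments, so that further conditions can be
  imposed on them; \<open>I\<close> is a \<open>(D,N)\<close>-implication in the unparametrised sense iff
  \<open>\<exists>D N. DN_implication D N I\<close>.
\<close>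

definition DN_implication ::
    "(real \<Rightarrow> real \<Rightarrow> real) \<Rightarrow> (real \<Rightarrow> real) \<Rightarrow> (real \<Rightarrow> real \<Rightarrow> real) \<Rightarrow> bool" where
  "DN_implication D N I \<longleftrightarrow>
     unit_fun2 I \<and> fuzzy_disjunction D \<and> fuzzy_negation N \<and>
     (\<forall>x\<in>unit_interval. \<forall>y\<in>unit_interval. I x y = D (N x) y)"

definition natural_negation :: "(real \<Rightarrow> real \<Rightarrow> real) \<Rightarrow> real \<Rightarrow> real" where
  "natural_negation I x = I x 0"

end

theory Submission
  imports Defs
begin

text \<open>
  A strict fuzzy negation \<open>N\<close> is a homeomorphism of the unit interval onto itself
  (\<open>strict_fuzzy_negation_homeomorphism\<close>).  Hence \<open>I x y = D (N x) y\<close> says that \<open>I\<close> and \<open>D\<close>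
  differ only by a homeomorphic change of the first variable, and one of them is continuous iff
  the other is (\<open>DN_implication_continuous_iff\<close>).  Putting \<open>y = 0\<close> gives \<open>I x 0 = D (N x) 0\<close>,
  and since \<open>N\<close> is onto, \<open>0\<close> is a right neutral element of \<open>D\<close> exactly when \<open>N\<close> agrees with the natural
  negation of \<open>I\<close> on the unit interval (\<open>right_neutral_0_iff_natural_negation\<close>).  So the same disjunction \<open>D\<close>
  serves in both directions of the equivalence.
\<close>

lemma strict_fuzzy_negation_homeomorphism:
  assumes "strict_fuzzy_negation N"
  obtains M where "homeomorphism unit_interval unit_interval N M"
proof -
  have into: "N ` unit_interval \<subseteq> unit_interval"
    and ends: "N 0 = 1" "N 1 = 0"
    and cont: "continuous_on unit_interval N"
    and strict: "strict_antimono_on unit_interval N"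
    using assms
    by (auto simp: strict_fuzzy_negation_def fuzzy_negation_def unit_fun1_def)
  have "\<exists>x\<in>unit_interval. N x = u" if "u \<in> unit_interval" for u
    using IVT2'[of N 1 u 0] that ends cont by auto
  then have onto: "N ` unit_interval = unit_interval"
    using into by blast
  have "inj_on N unit_interval"
    using strict by (auto intro!: linorder_inj_onI' dest: monotone_onD)
  with onto cont obtain M where "homeomorphism unit_interval unit_interval N M"
    using homeomorphism_compact[OF compact_Icc, of 0 1 N unit_interval] by blast
  then show thesis by (rule that)
qed

lemma continuous_unit2_reparametrize:
  assumes "continuous_unit2 G"
    and "continuous_on unit_interval h" "h ` unit_interval \<subseteq> unit_interval"
    and eq: "\<forall>x\<in>unit_interval. \<forall>y\<in>unit_interval. F x y = G (h x) y"
  shows "continuous_unit2 F"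
proof -
  let ?Q = "unit_interval \<times> unit_interval"
  have "continuous_on ?Q (\<lambda>p. h (fst p))"
    by (rule continuous_on_compose2[OF assms(2) continuous_on_fst]) (auto intro: continuous_intros)
  then have "continuous_on ?Q (\<lambda>p. (h (fst p), snd p))"
    by (intro continuous_on_Pair continuous_on_snd continuous_on_id)
  then have "continuous_on ?Q (\<lambda>p. case (h (fst p), snd p) of (x, y) \<Rightarrow> G x y)"
    using assms(3)
    by (intro continuous_on_compose2[OF assms(1)[unfolded continuous_unit2_def]]) auto
  then have "continuous_on ?Q (\<lambda>(x, y). F x y)"
    by (rule continuous_on_eq) (auto simp: eq)
  then show ?thesis
    by (simp add: continuous_unit2_def)
qed

lemma DN_implication_continuous_iff:
  assumes "DN_implication D N I" "strict_fuzzy_negation N"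
  shows "continuous_unit2 I \<longleftrightarrow> continuous_unit2 D"
proof -
  obtain M where hom: "homeomorphism unit_interval unit_interval N M"
    using assms(2) by (rule strict_fuzzy_negation_homeomorphism)
  note N = homeomorphism_cont1[OF hom] homeomorphism_image1[OF hom]
  note M = homeomorphism_cont2[OF hom] homeomorphism_image2[OF hom]
  have I: "\<forall>x\<in>unit_interval. \<forall>y\<in>unit_interval. I x y = D (N x) y"
    using assms(1) by (simp add: DN_implication_def)
  have D: "\<forall>u\<in>unit_interval. \<forall>y\<in>unit_interval. D u y = I (M u) y"
  proof (intro ballI)
    fix u y :: real
    assume u: "u \<in> unit_interval" and y: "y \<in> unit_interval"
    have "M u \<in> unit_interval"
      using M(2) u by blast
    then have "I (M u) y = D (N (M u)) y"
      using I y by blast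
    then show "D u y = I (M u) y"
      using homeomorphism_apply2[OF hom u] by simp
  qed
  show ?thesis
    using continuous_unit2_reparametrize[OF _ N(1) equalityD1[OF N(2)] I]
      continuous_unit2_reparametrize[OF _ M(1) equalityD1[OF M(2)] D]
    by (rule iffI[rotated])
qed

lemma right_neutral_0_iff_natural_negation:
  assumes "DN_implication D N I" "strict_fuzzy_negation N"
  shows "right_neutral_0 D \<longleftrightarrow> (\<forall>x\<in>unit_interval. natural_negation I x = N x)"
proof -
  obtain M where "homeomorphism unit_interval unit_interval N M"
    using assms(2) by (rule strict_fuzzy_negation_homeomorphism)
  then have onto: "N ` unit_interval = unit_interval"
    by (rule homeomorphism_image1)
  have "natural_negation I x = D (N x) 0" if "x \<in> unit_interval" for x
    using assms(1) that by (auto simp: DN_implication_def natural_negation_def)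
  then have "(\<forall>x\<in>unit_interval. natural_negation I x = N x)
      \<longleftrightarrow> (\<forall>u\<in>N ` unit_interval. D u 0 = u)"
    by simp
  then show ?thesis
    unfolding onto right_neutral_0_def by simp
qed

lemma strict_fuzzy_negation_cong:
  assumes "\<forall>x\<in>unit_interval. N x = N' x"
  shows "strict_fuzzy_negation N \<longleftrightarrow> strict_fuzzy_negation N'"
proof -
  have "continuous_on unit_interval N \<longleftrightarrow> continuous_on unit_interval N'"
    using assms by (intro continuous_on_cong) auto
  then show ?thesis
    using assms
    by (simp add: strict_fuzzy_negation_def fuzzy_negation_def unit_fun1_def monotone_on_def)
qed

lemma DN_implication_cong:
  assumes "\<forall>x\<in>unit_interval. N x = N' x"
  shows "DN_implication D N I \<longleftrightarrow> DN_implication D N' I"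
  using assms
  by (simp add: DN_implication_def fuzzy_negation_def unit_fun1_def monotone_on_def)

theorem theorem4p2:
  fixes I :: "real \<Rightarrow> real \<Rightarrow> real"
  assumes "unit_fun2 I"
  shows "(continuous_unit2 I \<and>
            (\<exists>D N. DN_implication D N I \<and> strict_fuzzy_negation N \<and> right_neutral_0 D))
         \<longleftrightarrow>
         (strict_fuzzy_negation (natural_negation I) \<and>
            (\<exists>D. DN_implication D (natural_negation I) I \<and> continuous_unit2 D))"
    (is "?L \<longleftrightarrow> ?R")
proof
  assume ?L
  then obtain D N where cont: "continuous_unit2 I" and DN: "DN_implication D N I"
    and strict: "strict_fuzzy_negation N" and "right_neutral_0 D"
    by blast
  then have eq: "\<forall>x\<in>unit_interval. natural_negation I x = N x"
    using right_neutral_0_iff_natural_negation by blast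
  have "strict_fuzzy_negation (natural_negation I)"
    using strict strict_fuzzy_negation_cong[OF eq] by blast
  moreover have "DN_implication D (natural_negation I) I"
    using DN DN_implication_cong[OF eq] by blast
  moreover have "continuous_unit2 D"
    using DN_implication_continuous_iff[OF DN strict] cont by blast
  ultimately show ?R by blast
next
  assume ?R
  then obtain D where strict: "strict_fuzzy_negation (natural_negation I)"
    and DN: "DN_implication D (natural_negation I) I" and "continuous_unit2 D"
    by blast
  then have "continuous_unit2 I"
    using DN_implication_continuous_iff by blast
  moreover have "right_neutral_0 D"
    using right_neutral_0_iff_natural_negation[OF DN strict] by blast
  ultimately show ?L
    using DN strict by blast
qed

end
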